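(* The worst-case running time of the algorithm Monitor-BFair (defined in the context), on a window with $k$ blocks and a protected attribute with $\ell$ values, is $\mathcal{O}(k\times \ell)$.
   Context: A window $W$ of $|W|$ items, each carrying one of $\ell$ values of a protected attribute, is divided into $k$ consecutive blocks of $s=|W|/k$ items each. A fairness constraint assigns to each value $p\in\{1,\dots,\ell\}$ a proportion $f(p)$, with $\sum_p f(p)=1$. The window is fair if in every block and for every $p$ the number of items with value $p$ lies in $[\lfloor f(p)s\rfloor,\lceil f(p)s\rceil]$; otherwise unfair. The (already constructed) forward sketch of $W$ is a list $S$ of $|W|$ vectors of length $\ell-1$, where $S[i][j]$ is the number of items among the first $i$ items of $W$ with value $j$ ($1\le j\le \ell-1$). Algorithm Monitor-BFair, with input $S$, $s$, $k$, $f$: for $b=1,\dots,k$: set $countVec=S[s]$ if $b=1$ and $countVec=S[bs]-S[(b-1)s]$ if $b>1$; set $lastCount=s-\sum_{j=1}^{\ell-1}countVec[j]$; let $fullVec=(countVec[1],\dots,countVec[\ell-1],lastCount)$; for $p=1,\dots,\ell$, if $fullVec[p]<\lfloor f(p)s\rfloor$ or $fullVec[p]>\lceil f(p)s\rceil$, return Unfair and terminate. If the loop over $b$ completes, return Fair. Time is counted in elementary operations on single numbers (arithmetic, comparison, rounding, access to a sketch coordinate each cost $O(1)$); the construction of $S$ is not counted. *)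

theory Defs
  imports Complex_Main "HOL-Library.Landau_Symbols" "HOL-Library.Extended_Nat"
    "HOL-Library.Monad_Syntax"
begin

text \<open>
  Programs are written in a writer monad: next to its result, a computation carries the trace
  of all elementary operations it has executed.  Data is touched only through the primitives
  below, each of which logs exactly one operation; sequencing, branching on an already computed
  truth value and returning are not charged.
\<close>

datatype elem_op = Arith | Compare | Round | Access

type_synonym 'a prog = "'a \<times> elem_op list"

definition ret :: "'a \<Rightarrow> 'a prog" where
  "ret x = (x, [])"

definition bind_prog :: "'a prog \<Rightarrow> ('a \<Rightarrow> 'b prog) \<Rightarrow> 'b prog" where
  "bind_prog m g = (fst (g (fst m)), snd m @ snd (g (fst m)))"

adhoc_overloading Monad_Syntax.bind \<rightleftharpoons> bind_prog

definition add_op :: "'a::plus \<Rightarrow> 'a \<Rightarrow> 'a prog" where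
  "add_op x y = (x + y, [Arith])"

definition sub_op :: "'a::minus \<Rightarrow> 'a \<Rightarrow> 'a prog" where
  "sub_op x y = (x - y, [Arith])"

definition mult_op :: "'a::times \<Rightarrow> 'a \<Rightarrow> 'a prog" where
  "mult_op x y = (x * y, [Arith])"

definition eq_op :: "'a \<Rightarrow> 'a \<Rightarrow> bool prog" where
  "eq_op x y = (x = y, [Compare])"

definition less_op :: "'a::ord \<Rightarrow> 'a \<Rightarrow> bool prog" where
  "less_op x y = (x < y, [Compare])"

definition floor_op :: "real \<Rightarrow> int prog" where
  "floor_op x = (\<lfloor>x\<rfloor>, [Round])"

definition ceiling_op :: "real \<Rightarrow> int prog" where
  "ceiling_op x = (\<lceil>x\<rceil>, [Round])"

text \<open>
  All vectors are indexed from 1.  The sketch is a list of lists, hence the index shift.  Local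
  vectors and the constraint are arrays, modelled as functions of the index.
\<close>

definition read_sketch :: "int list list \<Rightarrow> nat \<Rightarrow> nat \<Rightarrow> int prog" where
  "read_sketch S i j = (S ! (i - 1) ! (j - 1), [Access])"

definition read_vec :: "(nat \<Rightarrow> 'a) \<Rightarrow> nat \<Rightarrow> 'a prog" where
  "read_vec v j = (v j, [Access])"

definition write_vec :: "(nat \<Rightarrow> 'a) \<Rightarrow> nat \<Rightarrow> 'a \<Rightarrow> (nat \<Rightarrow> 'a) prog" where
  "write_vec v j x = (v(j := x), [Access])"

text \<open>
  The contents of a newly allocated vector are never read before they have been written; the
  value 0 is arbitrary.
\<close>

definition new_vec :: "nat \<Rightarrow> int" where
  "new_vec = (\<lambda>_. 0)"

text \<open>
  Loops over \<open>i, \<dots>, n\<close>.  Each test of the loop condition costs one comparison (including the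
  final, failing one) and each increment of the counter one arithmetic operation.
\<close>

function for_loop :: "nat \<Rightarrow> nat \<Rightarrow> (nat \<Rightarrow> 'a \<Rightarrow> 'a prog) \<Rightarrow> 'a \<Rightarrow> 'a prog" where
  "for_loop i n body x =
     (if i \<le> n
      then do {
        _ \<leftarrow> ((), [Compare]);
        y \<leftarrow> body i x;
        _ \<leftarrow> ((), [Arith]);
        for_loop (i + 1) n body y }
      else do {
        _ \<leftarrow> ((), [Compare]);
        ret x })"
  by pat_completeness auto
termination
  by (relation "measure (\<lambda>(i, n, _, _). Suc n - i)") auto

datatype verdict = Fair | Unfair

text \<open>The loop is left at the first iteration whose body yields \<^term>\<open>Unfair\<close>.\<close>

function check_loop :: "nat \<Rightarrow> nat \<Rightarrow> (nat \<Rightarrow> verdict prog) \<Rightarrow> verdict prog" where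
  "check_loop i n body =
     (if i \<le> n
      then do {
        _ \<leftarrow> ((), [Compare]);
        r \<leftarrow> body i;
        (case r of
           Unfair \<Rightarrow> ret Unfair
         | Fair \<Rightarrow> do {
             _ \<leftarrow> ((), [Arith]);
             check_loop (i + 1) n body }) }
      else do {
        _ \<leftarrow> ((), [Compare]);
        ret Fair })"
  by pat_completeness auto
termination
  by (relation "measure (\<lambda>(i, n, _). Suc n - i)") auto

declare for_loop.simps [simp del] check_loop.simps [simp del]

definition compute_count_vec ::
    "int list list \<Rightarrow> nat \<Rightarrow> nat \<Rightarrow> nat \<Rightarrow> (nat \<Rightarrow> int) prog" where
  "compute_count_vec S s l b = do {
     m \<leftarrow> sub_op l 1;
     first \<leftarrow> eq_op b 1;
     if first
     then for_loop 1 m (\<lambda>j v. do {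
            x \<leftarrow> read_sketch S s j;
            write_vec v j x }) new_vec
     else do {
       end_idx \<leftarrow> mult_op b s;
       b' \<leftarrow> sub_op b 1;
       start_idx \<leftarrow> mult_op b' s;
       for_loop 1 m (\<lambda>j v. do {
         x \<leftarrow> read_sketch S end_idx j;
         y \<leftarrow> read_sketch S start_idx j;
         d \<leftarrow> sub_op x y;
         write_vec v j d }) new_vec } }"

definition compute_last_count :: "(nat \<Rightarrow> int) \<Rightarrow> nat \<Rightarrow> nat \<Rightarrow> int prog" where
  "compute_last_count count_vec s l = do {
     m \<leftarrow> sub_op l 1;
     total \<leftarrow> for_loop 1 m (\<lambda>j acc. do {
       x \<leftarrow> read_vec count_vec j;
       add_op acc x }) 0;
     sub_op (int s) total }"

definition compute_full_vec ::
    "(nat \<Rightarrow> int) \<Rightarrow> int \<Rightarrow> nat \<Rightarrow> (nat \<Rightarrow> int) prog" where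
  "compute_full_vec count_vec last_count l = do {
     m \<leftarrow> sub_op l 1;
     v \<leftarrow> for_loop 1 m (\<lambda>j v. do {
       x \<leftarrow> read_vec count_vec j;
       write_vec v j x }) new_vec;
     write_vec v l last_count }"

definition check_value ::
    "(nat \<Rightarrow> int) \<Rightarrow> nat \<Rightarrow> (nat \<Rightarrow> real) \<Rightarrow> nat \<Rightarrow> verdict prog" where
  "check_value full_vec s f p = do {
     x \<leftarrow> read_vec full_vec p;
     q \<leftarrow> read_vec f p;
     t \<leftarrow> mult_op q (real s);
     lower \<leftarrow> floor_op t;
     below \<leftarrow> less_op x lower;
     if below then ret Unfair
     else do {
       upper \<leftarrow> ceiling_op t;
       above \<leftarrow> less_op upper x;
       if above then ret Unfair else ret Fair } }"

definition monitor_bfair ::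
    "int list list \<Rightarrow> nat \<Rightarrow> nat \<Rightarrow> (nat \<Rightarrow> real) \<Rightarrow> nat \<Rightarrow> verdict prog" where
  "monitor_bfair S s k f l =
     check_loop 1 k (\<lambda>b. do {
       count_vec \<leftarrow> compute_count_vec S s l b;
       last_count \<leftarrow> compute_last_count count_vec s l;
       full_vec \<leftarrow> compute_full_vec count_vec last_count l;
       check_loop 1 l (check_value full_vec s f) })"

text \<open>A window is represented by the list of the protected values of its items.\<close>

definition forward_sketch :: "nat \<Rightarrow> nat list \<Rightarrow> int list list" where
  "forward_sketch l W =
     map (\<lambda>i. map (\<lambda>j. int (count_list (take i W) j)) [1..<l]) [1..<Suc (length W)]"

definition fairness_constraint :: "nat \<Rightarrow> (nat \<Rightarrow> real) \<Rightarrow> bool" where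
  "fairness_constraint l f \<longleftrightarrow> (\<forall>p\<in>{1..l}. 0 \<le> f p) \<and> (\<Sum>p=1..l. f p) = 1"

text \<open>The inputs with \<open>k\<close> blocks (of any size \<open>s\<close>) and \<open>l\<close> values.\<close>

definition inputs :: "nat \<Rightarrow> nat \<Rightarrow> (nat \<times> (nat \<Rightarrow> real) \<times> nat list) set" where
  "inputs k l = {(s, f, W). s \<ge> 1 \<and> length W = k * s \<and> set W \<subseteq> {1..l} \<and>
     fairness_constraint l f}"

text \<open>
  An elementary operation of kind \<open>e\<close> takes \<open>cost e\<close> time units, a constant independent of the
  input; \<open>cost = (\<lambda>_. 1)\<close> counts operations.
\<close>

definition running_time ::
    "(elem_op \<Rightarrow> nat) \<Rightarrow> nat \<Rightarrow> nat \<Rightarrow> nat \<Rightarrow> (nat \<Rightarrow> real) \<Rightarrow> nat list \<Rightarrow> nat" where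
  "running_time cost k l s f W =
     sum_list (map cost (snd (monitor_bfair (forward_sketch l W) s k f l)))"

text \<open>
  For fixed \<open>k\<close> and \<open>l\<close> there are infinitely many inputs, so the supremum is taken in
  \<^typ>\<open>enat\<close>, where it is meaningful without a boundedness assumption.
\<close>

definition worst_case_time :: "(elem_op \<Rightarrow> nat) \<Rightarrow> nat \<Rightarrow> nat \<Rightarrow> enat" where
  "worst_case_time cost k l =
     (SUP (s, f, W) \<in> inputs k l. enat (running_time cost k l s f W))"

end

theory Submission
  imports Defs
begin

text \<open>Each block is handled by a fixed number of passes over at most \<open>l\<close> vector
  positions, and every pass does a constant number of operations per position; the sketch gives the
  block counts by subtraction, so the block size \<open>s\<close> never enters. A block thus costs
  O(\<open>l\<close>) operations and \<open>k\<close> blocks cost O(\<open>k * l\<close>).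
  \<open>trace_length_for_loop\<close> and \<open>trace_length_check_loop\<close> turn a uniform
  bound on a loop body into one on the loop; composing them gives at most
  \<open>27 * (k * l)\<close> operations in \<open>trace_length_monitor_bfair\<close>, for any
  sketch and constraint. As there are only four kinds of operation, their costs have a common bound
  \<open>c\<close>, so the supremum over all inputs is at most
  \<open>27 * c * (k * l)\<close>.\<close>

definition trace_length :: "'a prog \<Rightarrow> nat" where
  "trace_length m = length (snd m)"

lemma trace_length_bind [simp]:
  "trace_length (bind_prog m g) = trace_length m + trace_length (g (fst m))"
  by (simp add: trace_length_def bind_prog_def)

lemma trace_length_Pair [simp]: "trace_length (x, ops) = length ops"
  by (simp add: trace_length_def)

lemmas primitive_defs = ret_def add_op_def sub_op_def mult_op_def eq_op_def less_op_def
  floor_op_def ceiling_op_def read_sketch_def read_vec_def write_vec_def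

text \<open>Each iteration adds one test and one increment to the body, hence \<open>B + 2\<close>;
  the final \<open>1\<close> is the failing test. The induction is on the number of remaining
  iterations, because the counter moves upwards. Since \<open>B\<close> is uniform in the state, the
  values computed need not be tracked.\<close>

lemma trace_length_for_loop:
  assumes "\<And>j y. trace_length (body j y) \<le> B"
  shows "trace_length (for_loop i n body x) \<le> (Suc n - i) * (B + 2) + 1"
proof (induction "Suc n - i" arbitrary: i x)
  case 0
  then show ?case
    by (subst for_loop.simps) (simp add: ret_def)
next
  case (Suc d)
  have d: "d = Suc n - (i + 1)"
    using Suc.hyps(2) by simp
  define y where "y = fst (body i x)"
  have "trace_length (for_loop (i + 1) n body y) \<le> d * (B + 2) + 1"
    using Suc.hyps(1)[OF d] by (simp only: flip: d)
  moreover have "trace_length (for_loop i n body x)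
      = trace_length (body i x) + trace_length (for_loop (i + 1) n body y) + 2"
    using Suc.hyps(2) by (subst for_loop.simps) (auto simp: y_def)
  moreover have "(Suc n - i) * (B + 2) = d * (B + 2) + (B + 2)"
    by (simp flip: Suc.hyps(2))
  ultimately show ?case
    using assms[of i x] by linarith
qed

text \<open>Leaving early only shortens the trace, so a full run is the worst case; the unfolding
  step is therefore an inequality here.\<close>

lemma trace_length_check_loop:
  assumes "\<And>j. trace_length (body j) \<le> B"
  shows "trace_length (check_loop i n body) \<le> (Suc n - i) * (B + 2) + 1"
proof (induction "Suc n - i" arbitrary: i)
  case 0
  then show ?case
    by (subst check_loop.simps) (simp add: ret_def)
next
  case (Suc d)
  have d: "d = Suc n - (i + 1)"
    using Suc.hyps(2) by simp
  have "trace_length (check_loop (i + 1) n body) \<le> d * (B + 2) + 1"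
    using Suc.hyps(1)[OF d] by (simp only: flip: d)
  moreover have "trace_length (check_loop i n body)
      \<le> trace_length (body i) + trace_length (check_loop (i + 1) n body) + 2"
    using Suc.hyps(2)
    by (subst check_loop.simps) (simp add: ret_def split: verdict.split)
  moreover have "(Suc n - i) * (B + 2) = d * (B + 2) + (B + 2)"
    by (simp flip: Suc.hyps(2))
  ultimately show ?case
    using assms[of i] by linarith
qed

lemma trace_length_compute_count_vec:
  assumes "l \<ge> 1"
  shows "trace_length (compute_count_vec S s l b) \<le> 6 * l"
proof -
  \<comment> \<open>This body performs only two operations; the slack bound 4 matches that of the
    other branch.\<close>
  have "trace_length (for_loop 1 (l - 1) (\<lambda>j v. do {
          x \<leftarrow> read_sketch S s j;
          write_vec v j x }) new_vec) \<le> (Suc (l - 1) - 1) * (4 + 2) + 1"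
    by (rule trace_length_for_loop) (simp add: primitive_defs)
  moreover have "trace_length (for_loop 1 (l - 1) (\<lambda>j v. do {
          x \<leftarrow> read_sketch S (b * s) j;
          y \<leftarrow> read_sketch S ((b - 1) * s) j;
          d \<leftarrow> sub_op x y;
          write_vec v j d }) new_vec) \<le> (Suc (l - 1) - 1) * (4 + 2) + 1"
    by (rule trace_length_for_loop) (simp add: primitive_defs)
  ultimately show ?thesis
    using assms by (cases l) (auto simp: compute_count_vec_def sub_op_def eq_op_def mult_op_def)
qed

lemma trace_length_compute_last_count:
  assumes "l \<ge> 1"
  shows "trace_length (compute_last_count count_vec s l) \<le> 4 * l"
proof -
  have "trace_length (for_loop 1 (l - 1) (\<lambda>j acc. do {
          x \<leftarrow> read_vec count_vec j;
          add_op acc x }) 0) \<le> (Suc (l - 1) - 1) * (2 + 2) + 1"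
    by (rule trace_length_for_loop) (simp add: primitive_defs)
  then show ?thesis
    using assms by (simp add: compute_last_count_def sub_op_def)
qed

lemma trace_length_compute_full_vec:
  assumes "l \<ge> 1"
  shows "trace_length (compute_full_vec count_vec last_count l) \<le> 4 * l"
proof -
  have "trace_length (for_loop 1 (l - 1) (\<lambda>j v. do {
          x \<leftarrow> read_vec count_vec j;
          write_vec v j x }) new_vec) \<le> (Suc (l - 1) - 1) * (2 + 2) + 1"
    by (rule trace_length_for_loop) (simp add: primitive_defs)
  then show ?thesis
    using assms by (simp add: compute_full_vec_def sub_op_def write_vec_def)
qed

lemma trace_length_check_value: "trace_length (check_value full_vec s f p) \<le> 7"
  by (simp add: check_value_def primitive_defs)

lemma trace_length_monitor_bfair:
  assumes "k \<ge> 1" "l \<ge> 1"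
  shows "trace_length (monitor_bfair S s k f l) \<le> 27 * (k * l)"
proof -
  have checks: "trace_length (check_loop 1 l (check_value v s f)) \<le> 9 * l + 1" for v
    using trace_length_check_loop[of "check_value v s f" 7 1 l] trace_length_check_value
    by simp
  have "trace_length (monitor_bfair S s k f l) \<le> (Suc k - 1) * (24 * l + 2) + 1"
    unfolding monitor_bfair_def
  proof (rule trace_length_check_loop)
    fix b
    define c where "c = fst (compute_count_vec S s l b)"
    define t where "t = fst (compute_last_count c s l)"
    define v where "v = fst (compute_full_vec c t l)"
    \<comment> \<open>The four phases add up to \<open>6 * l + 4 * l + 4 * l + (9 * l + 1)\<close>,
      and \<open>1 \<le> l\<close> absorbs the last term.\<close>
    show "trace_length (do {
        count_vec \<leftarrow> compute_count_vec S s l b;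
        last_count \<leftarrow> compute_last_count count_vec s l;
        full_vec \<leftarrow> compute_full_vec count_vec last_count l;
        check_loop 1 l (check_value full_vec s f) }) \<le> 24 * l"
      using trace_length_compute_count_vec[OF assms(2), of S s b]
        trace_length_compute_last_count[OF assms(2), of c s]
        trace_length_compute_full_vec[OF assms(2), of c t] checks[of v] assms(2)
      by (simp flip: c_def t_def v_def)
  qed
  also have "\<dots> = 24 * (k * l) + 2 * k + 1"
    by (simp add: algebra_simps)
  \<comment> \<open>Both \<open>k\<close> and 1 are at most \<open>k * l\<close>, so
    \<open>2 * k + 1\<close> costs three more multiples of it.\<close>
  also have "\<dots> \<le> 27 * (k * l)"
  proof -
    have "k * 1 \<le> k * l"
      using assms by (intro mult_le_mono2)
    then show ?thesis
      using assms by linarith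
  qed
  finally show ?thesis .
qed

lemma sum_list_map_le_length_mult:
  fixes h :: "'a \<Rightarrow> nat"
  assumes "\<And>x. x \<in> set xs \<Longrightarrow> h x \<le> c"
  shows "sum_list (map h xs) \<le> length xs * c"
  using sum_list_mono[of xs h "\<lambda>_. c"] assms by (simp add: sum_list_triv)

lemma cost_bounded: "\<exists>c. \<forall>e. (cost :: elem_op \<Rightarrow> nat) e \<le> c"
proof
  show "\<forall>e. cost e \<le> cost Arith + cost Compare + cost Round + cost Access"
  proof
    show "cost e \<le> cost Arith + cost Compare + cost Round + cost Access" for e
      by (cases e) auto
  qed
qed

lemma worst_case_time_le:
  assumes "\<And>e. cost e \<le> c" "k \<ge> 1" "l \<ge> 1"
  shows "worst_case_time cost k l \<le> enat (27 * c * (k * l))"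
  unfolding worst_case_time_def
proof (intro SUP_least, clarify)
  fix s f W
  let ?m = "monitor_bfair (forward_sketch l W) s k f l"
  have "running_time cost k l s f W \<le> trace_length ?m * c"
    unfolding running_time_def trace_length_def
    using assms(1) by (rule sum_list_map_le_length_mult)
  also have "\<dots> \<le> 27 * (k * l) * c"
    using assms(2,3) by (intro mult_le_mono1 trace_length_monitor_bfair)
  finally show "enat (running_time cost k l s f W) \<le> enat (27 * c * (k * l))"
    by (simp add: mult_ac)
qed

theorem lemma3p4:
  fixes cost :: "elem_op \<Rightarrow> nat"
  shows "(\<forall>k\<ge>1. \<forall>l\<ge>1. worst_case_time cost k l < \<infinity>) \<and>
    (\<lambda>(k, l). real (the_enat (worst_case_time cost k l)))
      \<in> O[principal {(k, l). k \<ge> 1 \<and> l \<ge> 1}](\<lambda>(k, l). real k * real l)"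
proof -
  obtain c where c: "\<And>e. cost e \<le> c"
    using cost_bounded by blast
  note bound = worst_case_time_le[of cost c, OF c]
  have "worst_case_time cost k l < \<infinity>" if "k \<ge> 1" "l \<ge> 1" for k l
    using bound[OF that] by (rule order.strict_trans1) simp
  moreover have "real (the_enat (worst_case_time cost k l)) \<le> real (27 * c) * (real k * real l)"
    if "k \<ge> 1" "l \<ge> 1" for k l
  proof -
    \<comment> \<open>The bound excludes \<infinity>, where \<open>the_enat\<close> would carry no
      information.\<close>
    have "the_enat (worst_case_time cost k l) \<le> 27 * c * (k * l)"
      using bound[OF that] by (cases "worst_case_time cost k l") auto
    then show ?thesis
      by (metis of_nat_le_iff of_nat_mult)
  qed
  ultimately show ?thesis
    \<comment> \<open>For a principal filter, eventually means everywhere on the set, so the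
      pointwise bound suffices.\<close>
    by (auto intro!: bigoI[where c = "real (27 * c)"] simp: eventually_principal)
qed

end
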